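(* For every integer $\ell\ge 4$, $m_{\ell-1}(\ell)\leq 2\ell^{\ell-3}$.
   Context: For $S\subset[n]$, $\mathcal F(\overline S)=\{F\in\mathcal F: F\cap S=\emptyset\}$ and $\gamma_j(\mathcal F)=\min_{S\in\binom{[n]}{j}}|\mathcal F(\overline S)|$. $\tau(\mathcal F)$ is the minimum size of a set meeting all members of $\mathcal F$. For $0\le j<k$, $m_j(k)$ is the maximum of $\gamma_j(\mathcal F)$ over all $n$ and all intersecting families $\mathcal F\subset\binom{[n]}{k}$ (any two members intersect) with $\tau(\mathcal F)=k$. *)

theory Defs
  imports Main
begin

definition intersecting :: "nat set set \<Rightarrow> bool" where
  "intersecting F \<longleftrightarrow> (\<forall>A\<in>F. \<forall>B\<in>F. A \<inter> B \<noteq> {})"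

definition avoid :: "nat set set \<Rightarrow> nat set \<Rightarrow> nat set set" where
  "avoid F S = {A \<in> F. A \<inter> S = {}}"

definition gamma :: "nat \<Rightarrow> nat \<Rightarrow> nat set set \<Rightarrow> nat" where
  "gamma n j F = Min {card (avoid F S) | S. S \<subseteq> {1..n} \<and> card S = j}"

definition tau :: "nat set set \<Rightarrow> nat" where
  "tau F = (LEAST t. \<exists>T. finite T \<and> card T = t \<and> (\<forall>A\<in>F. A \<inter> T \<noteq> {}))"

(* the admissible families in the definition of m_j(k) *)
definition admissible :: "nat \<Rightarrow> nat \<Rightarrow> nat set set \<Rightarrow> bool" where
  "admissible n k F \<longleftrightarrow> F \<subseteq> {A. A \<subseteq> {1..n} \<and> card A = k} \<and> intersecting F \<and> tau F = k"

end

(* Let N = 2 l^(l-3) and suppose that every (l-1)-set is avoided by more than N members of F.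
   As no set of fewer than l points is a cover, the number of members containing a set T grows
   by a factor of at most l when a point is removed from T. A member avoiding S must contain
   every y for which S + y is in F. Hence an (l-1)-set S lies in at most two members (three of
   them would leave at most l^(l-3) members avoiding S); by the improved count this gives at
   most 2 l^(l-3) members through any pair, so S lies in at most one member. Likewise, if an
   (l-2)-set T were contained in two members T + s + x and T + a + b, then every member avoiding
   T + s would contain {x, a} or {x, b}, and there are at most 2 l^(l-3) of these. So an
   (l-2)-set lies in at most one member, and at most l^(l-3) members pass through a point x,
   in particular at most that many avoid A - x for x in A in F. *)

theory Submission
  imports Defs
begin

definition containing :: "nat set set \<Rightarrow> nat set \<Rightarrow> nat set set" where
  "containing F T = {A \<in> F. T \<subseteq> A}"

definition degree_le :: "nat set set \<Rightarrow> nat \<Rightarrow> nat \<Rightarrow> bool" where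
  "degree_le F r c \<longleftrightarrow> (\<forall>T. finite T \<and> card T = r \<longrightarrow> card (containing F T) \<le> c)"

lemma degree_leD: "degree_le F r c \<Longrightarrow> finite T \<Longrightarrow> card T = r \<Longrightarrow> card (containing F T) \<le> c"
  by (simp add: degree_le_def)

lemma admissible_member:
  assumes "admissible n l F" "A \<in> F"
  shows "A \<subseteq> {1..n}" "finite A" "card A = l"
  using assms finite_subset[of A "{1..n}"] by (auto simp: admissible_def)

lemma admissible_meet:
  "admissible n l F \<Longrightarrow> A \<in> F \<Longrightarrow> B \<in> F \<Longrightarrow> A \<inter> B \<noteq> {}"
  by (auto simp: admissible_def intersecting_def)

lemma admissible_finite:
  assumes "admissible n l F"
  shows "finite F"
  by (rule finite_subset[of _ "Pow {1..n}"]) (use assms in \<open>auto simp: admissible_def\<close>)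

lemma finite_containing: "finite F \<Longrightarrow> finite (containing F T)"
  by (simp add: containing_def)

lemma admissible_disjoint_member:
  assumes "admissible n l F" "finite T" "card T < l"
  obtains A where "A \<in> F" "A \<inter> T = {}"
proof -
  have "card T < (LEAST t. \<exists>T. finite T \<and> card T = t \<and> (\<forall>A\<in>F. A \<inter> T \<noteq> {}))"
    using assms by (simp add: admissible_def tau_def)
  from not_less_Least[OF this] assms(2) that show ?thesis by blast
qed

lemma gamma_le_card_avoid:
  assumes "S \<subseteq> {1..n}" "card S = j"
  shows "gamma n j F \<le> card (avoid F S)"
proof -
  \<comment> \<open>\<open>Min\<close> is informative only on a finite set; here finiteness comes
    from the finitely many subsets of \<open>{1..n}\<close>.\<close>
  have "{card (avoid F S) | S. S \<subseteq> {1..n} \<and> card S = j} \<subseteq> (\<lambda>S. card (avoid F S)) ` Pow {1..n}"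
    by auto
  then have "finite {card (avoid F S) | S. S \<subseteq> {1..n} \<and> card S = j}"
    by (rule finite_subset) simp
  then show ?thesis unfolding gamma_def by (rule Min_le) (use assms in blast)
qed

lemma degree_le_uniformity:
  assumes "admissible n l F"
  shows "degree_le F l 1"
  unfolding degree_le_def
proof (intro allI impI)
  fix T :: "nat set" assume T: "finite T \<and> card T = l"
  have "containing F T \<subseteq> {T}"
  proof
    fix A assume "A \<in> containing F T"
    then have "A \<in> F" "T \<subseteq> A" by (auto simp: containing_def)
    with T admissible_member[OF assms \<open>A \<in> F\<close>] show "A \<in> {T}"
      by (metis card_subset_eq singletonI)
  qed
  from card_mono[OF _ this] show "card (containing F T) \<le> 1" by simp
qed

text \<open>Since T has fewer than l points, some member A is disjoint from it. Every member
  containing T meets A, hence contains \<open>insert a T\<close> for one of the l points a of A.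
  Each point removed thus costs a factor l.\<close>

lemma degree_le_diff:
  assumes "admissible n l F" "degree_le F r c" "r \<le> l" "d \<le> r"
  shows "degree_le F (r - d) (c * l ^ d)"
  using \<open>d \<le> r\<close>
proof (induction d)
  case 0
  with assms(2) show ?case by simp
next
  case (Suc d)
  show ?case unfolding degree_le_def
  proof (intro allI impI)
    fix T :: "nat set" assume T: "finite T \<and> card T = r - Suc d"
    with Suc.prems \<open>r \<le> l\<close> have "card T < l" by linarith
    with assms(1) T obtain A where A: "A \<in> F" "A \<inter> T = {}"
      using admissible_disjoint_member by blast
    note Am = admissible_member[OF assms(1) A(1)]
    have "containing F T \<subseteq> (\<Union>a\<in>A. containing F (insert a T))"
      using admissible_meet[OF assms(1) A(1)] by (fastforce simp: containing_def)
    then have "card (containing F T) \<le> card (\<Union>a\<in>A. containing F (insert a T))"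
      by (rule card_mono[rotated])
        (use Am finite_containing[OF admissible_finite[OF assms(1)]] in blast)
    also have "\<dots> \<le> (\<Sum>a\<in>A. card (containing F (insert a T)))"
      by (rule card_UN_le[OF Am(2)])
    also have "\<dots> \<le> (\<Sum>a\<in>A. c * l ^ d)"
    proof (rule sum_mono)
      fix a assume "a \<in> A"
      with A T Suc.prems have "card (insert a T) = r - d"
        by (subst card_insert_disjoint) auto
      with Suc T show "card (containing F (insert a T)) \<le> c * l ^ d"
        by (intro degree_leD[of F "r - d"]) auto
    qed
    also have "\<dots> = c * l ^ Suc d" using Am(3) by simp
    finally show "card (containing F T) \<le> c * l ^ Suc d" .
  qed
qed

lemma admissible_card_Diff:
  assumes "admissible n l F" "T \<subseteq> A" "A \<in> F"
  shows "card (A - T) = l - card T"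
  using admissible_member[OF assms(1,3)] assms(2) by (simp add: card_Diff_subset finite_subset)

text \<open>A member disjoint from S can meet \<open>insert y S\<close> only in y.\<close>

lemma avoid_subset_containing:
  assumes "admissible n l F" "\<And>y. y \<in> Y \<Longrightarrow> insert y S \<in> F"
  shows "avoid F S \<subseteq> containing F Y"
proof
  fix B assume "B \<in> avoid F S"
  then have B: "B \<in> F" "B \<inter> S = {}" by (auto simp: avoid_def)
  have "y \<in> B" if "y \<in> Y" for y
    using admissible_meet[OF assms(1) assms(2)[OF that] B(1)] B(2) by blast
  with B(1) show "B \<in> containing F Y" by (auto simp: containing_def)
qed

text \<open>Members through T extend it by single points, and a set avoiding T must pick up all of
  these points. Used contrapositively: if gamma exceeds c, at most k members contain T.\<close>

lemma gamma_le_codegree: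
  assumes adm: "admissible n l F" and "degree_le F (Suc k) c"
    and T: "finite T" "card T = l - 1" and big: "card (containing F T) > k" and l: "l \<ge> 1"
  shows "gamma n (l - 1) F \<le> c"
proof -
  obtain G where G: "G \<subseteq> containing F T" "card G = Suc k" "finite G"
    using obtain_subset_with_card_n[of "Suc k" "containing F T"] big by auto
  have ex: "\<exists>y. A = insert y T" if "A \<in> G" for A
  proof -
    from that G have "T \<subseteq> A" "A \<in> F" by (auto simp: containing_def)
    with admissible_card_Diff[OF adm] T l have "card (A - T) = 1" by simp
    then obtain y where "A - T = {y}" by (rule card_1_singletonE)
    with \<open>T \<subseteq> A\<close> show ?thesis by blast
  qed
  then obtain f where f: "\<And>A. A \<in> G \<Longrightarrow> A = insert (f A) T" by metis
  \<comment> \<open>With T fixed, the extra point determines the member, so \<open>Suc k\<close>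
    members yield \<open>Suc k\<close> distinct points.\<close>
  then have "inj_on f G" by (metis inj_onI)
  then have "card (f ` G) = Suc k" using G card_image by metis
  have "insert y T \<in> F" if "y \<in> f ` G" for y
    using that f G by (fastforce simp: containing_def)
  then have "card (avoid F T) \<le> card (containing F (f ` G))"
    by (intro card_mono finite_containing admissible_finite[OF adm]
        avoid_subset_containing[OF adm])
  also have "\<dots> \<le> c"
    by (rule degree_leD) (use assms G \<open>card (f ` G) = Suc k\<close> in auto)
  finally have "card (avoid F T) \<le> c" .
  \<comment> \<open>T inherits from a member that it lies in \<open>{1..n}\<close>, so it is a
    legitimate choice of S in \<open>gamma\<close>.\<close>
  moreover obtain A where "A \<in> G" using G by fastforce
  then have "A \<in> F" "T \<subseteq> A" using G by (auto simp: containing_def)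
  then have "T \<subseteq> {1..n}" using admissible_member(1)[OF adm] by blast
  ultimately show ?thesis using gamma_le_card_avoid[of T n "l - 1" F] T by simp
qed

text \<open>The avoided set is T with one point s of \<open>A - T\<close> added. Avoiding it leaves
  only x for meeting A, and the two points of \<open>B - T\<close> for meeting B.\<close>

lemma gamma_le_two_codegree:
  assumes adm: "admissible n l F" and one: "degree_le F (l - 1) 1" and pair: "degree_le F 2 c"
    and T: "finite T" "card T = l - 2" and big: "card (containing F T) > 1" and l: "l \<ge> 2"
  shows "gamma n (l - 1) F \<le> 2 * c"
proof -
  obtain G where "G \<subseteq> containing F T" "card G = 2"
    using obtain_subset_with_card_n[of 2 "containing F T"] big by auto
  then obtain A B where AB: "A \<in> F" "B \<in> F" "T \<subseteq> A" "T \<subseteq> B" "A \<noteq> B"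
    by (auto simp: card_2_iff containing_def)
  from admissible_card_Diff[OF adm] AB T l have "card (A - T) = 2" "card (B - T) = 2" by auto
  then obtain s x where sx: "A - T = {s, x}" "s \<noteq> x" by (meson card_2_iff)
  have disj: "(A - T) \<inter> (B - T) = {}"
  proof (rule ccontr)
    assume "(A - T) \<inter> (B - T) \<noteq> {}"
    then obtain z where z: "z \<in> A" "z \<in> B" "z \<notin> T" by blast
    \<comment> \<open>A common point z would place two members over a set of size l - 1, against
      \<open>one\<close>.\<close>
    then have "{A, B} \<subseteq> containing F (insert z T)" using AB by (auto simp: containing_def)
    then have "card {A, B} \<le> card (containing F (insert z T))"
      by (intro card_mono finite_containing admissible_finite[OF adm])
    also have "\<dots> \<le> 1"
      by (rule degree_leD[OF one]) (use T l z in auto)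
    finally show False using AB by simp
  qed
  have "avoid F (insert s T) \<subseteq> (\<Union>b\<in>B - T. containing F {x, b})"
  proof
    fix C assume "C \<in> avoid F (insert s T)"
    then have C: "C \<in> F" "s \<notin> C" "C \<inter> T = {}" by (auto simp: avoid_def)
    have "A \<subseteq> T \<union> {s, x}" using sx(1) unfolding Diff_subset_conv[symmetric] by (rule equalityD1)
    with admissible_meet[OF adm C(1) AB(1)] C have "x \<in> C" by blast
    moreover from admissible_meet[OF adm C(1) AB(2)] C obtain b where "b \<in> B - T" "b \<in> C" by blast
    ultimately show "C \<in> (\<Union>b\<in>B - T. containing F {x, b})"
      using C by (auto simp: containing_def)
  qed
  moreover have fB: "finite (B - T)" using admissible_member(2)[OF adm AB(2)] by simp
  ultimately have "card (avoid F (insert s T)) \<le> card (\<Union>b\<in>B - T. containing F {x, b})"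
    by (intro card_mono finite_UN_I finite_containing admissible_finite[OF adm])
  also have "\<dots> \<le> (\<Sum>b\<in>B - T. card (containing F {x, b}))"
    by (rule card_UN_le[OF fB])
  also have "\<dots> \<le> (\<Sum>b\<in>B - T. c)"
  proof (rule sum_mono)
    fix b assume "b \<in> B - T"
    \<comment> \<open>Disjointness makes \<open>{x, b}\<close> a genuine pair, so
      \<open>pair\<close> applies.\<close>
    with disj sx have "x \<noteq> b" by blast
    then show "card (containing F {x, b}) \<le> c" by (intro degree_leD[OF pair]) auto
  qed
  also have "\<dots> = 2 * c" using \<open>card (B - T) = 2\<close> by simp
  finally have "card (avoid F (insert s T)) \<le> 2 * c" .
  moreover have "insert s T \<subseteq> {1..n}"
    using admissible_member(1)[OF adm AB(1)] sx AB(3) by blast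
  moreover have "card (insert s T) = l - 1"
    using sx T l by (subst card_insert_disjoint) auto
  ultimately show ?thesis using gamma_le_card_avoid[of "insert s T" n "l - 1" F] by simp
qed

lemma gamma_le_degree:
  assumes adm: "admissible n l F" and "degree_le F 1 c" and l: "l \<ge> 1"
  shows "gamma n (l - 1) F \<le> c"
proof -
  \<comment> \<open>F is nonempty because the empty set is not a cover.\<close>
  obtain A where A: "A \<in> F"
    using admissible_disjoint_member[OF adm, of "{}"] l by auto
  note Am = admissible_member[OF adm A]
  from Am l obtain x where x: "x \<in> A" by fastforce
  have "gamma n (l - 1) F \<le> card (avoid F (A - {x}))"
    by (rule gamma_le_card_avoid) (use Am x in auto)
  also have "\<dots> \<le> card (containing F {x})"
    by (intro card_mono finite_containing admissible_finite[OF adm]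
        avoid_subset_containing[OF adm]) (use A x in \<open>auto simp: insert_absorb\<close>)
  also have "\<dots> \<le> c" by (rule degree_leD) (use assms in auto)
  finally show ?thesis .
qed

theorem theorem5p3:
  fixes l :: nat
  assumes "l \<ge> 4"
  shows "\<forall>n F. admissible n l F \<longrightarrow> gamma n (l - 1) F \<le> 2 * l ^ (l - 3)"
proof (intro allI impI, rule ccontr)
  fix n F assume adm: "admissible n l F"
  assume neg: "\<not> gamma n (l - 1) F \<le> 2 * l ^ (l - 3)"
  \<comment> \<open>Every descent below removes exactly l - 3 points: from l to 3, from l - 1 to 2
    (twice), and from l - 2 to 1. Hence the same power of l each time.\<close>
  have "degree_le F 3 (l ^ (l - 3))"
    using degree_le_diff[OF adm degree_le_uniformity[OF adm], of "l - 3"] assms by simp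
  then have "degree_le F (l - 1) 2"
    using gamma_le_codegree[OF adm, of 2 "l ^ (l - 3)"] neg assms
    unfolding degree_le_def by fastforce
  then have "degree_le F 2 (2 * l ^ (l - 3))"
    using degree_le_diff[OF adm, of "l - 1" 2 "l - 3"] assms by simp
  then have one: "degree_le F (l - 1) 1"
    using gamma_le_codegree[OF adm, of 1 "2 * l ^ (l - 3)"] neg assms
    unfolding degree_le_def by (fastforce simp: numeral_2_eq_2)
  then have "degree_le F 2 (l ^ (l - 3))"
    using degree_le_diff[OF adm, of "l - 1" 1 "l - 3"] assms by simp
  then have "degree_le F (l - 2) 1"
    using gamma_le_two_codegree[OF adm one, of "l ^ (l - 3)"] neg assms
    unfolding degree_le_def by fastforce
  then have "degree_le F 1 (l ^ (l - 3))"
    using degree_le_diff[OF adm, of "l - 2" 1 "l - 3"] assms by (simp add: Suc_diff_Suc numeral_eq_Suc)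
  then show False using gamma_le_degree[OF adm] neg assms by fastforce
qed

end
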